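(* Let $j$ be a neighbour of DGU $i$ in the communication network, and consider the DGU dynamics and the unknown-input-observer (UIO) based detector described in the context. Let a false data injection attack on the link $(i,j)$ start at time $T_a\ge 0$, with an attack vector $\boldsymbol\phi_{i,j}(t)\in\mathbb R^3$ that is continuous and differentiable. Then the attack is zero trace stealthy (ZTS) if and only if $\boldsymbol\phi_{i,j}$ satisfies $$\dot{\boldsymbol\phi}_{i,j}(t)=A_{kj}\boldsymbol\phi_{i,j}(t)+\bar E_j\bar{\boldsymbol d}^{a}_{ij}(t)\quad \forall t\ge T_a,\qquad \boldsymbol\phi_{i,j}(T_a)=\mathbf 0,$$ where $\bar{\boldsymbol d}^a_{ij}(t)\in\mathbb R^2$ (the fake unknown input) is such that $\bar E_j\bar{\boldsymbol d}^a_{ij}(t)$ is not identically $\mathbf 0$.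
   Context: Dynamics of DGU (distributed generation unit) $j$: $\dot{\boldsymbol x}_j=A_{kj}\boldsymbol x_j+\bar E_j\bar{\boldsymbol d}_j+\boldsymbol\omega_j+\boldsymbol b_j\boldsymbol k_j^{\rm T}\boldsymbol\rho_j$, $\boldsymbol y_j=\boldsymbol x_j+\boldsymbol\rho_j$, with $\boldsymbol x_j(t)\in\mathbb R^3$, $A_{kj}\in\mathbb R^{3\times3}$ and $\boldsymbol b_j,\boldsymbol k_j\in\mathbb R^3$ given, $\bar{\boldsymbol d}_j(t)\in\mathbb R^2$ an input unknown to DGU $i$, $\boldsymbol\omega_j,\boldsymbol\rho_j$ bounded process and measurement noise, and $$\bar E_j=\begin{bmatrix}\frac1{C_{tj}}&0\\0&0\\0&1\end{bmatrix},$$ where $C_{tj}>0$ is a capacitance. Attack: DGU $i$ receives $\boldsymbol y^c_{i,j}(t)=\boldsymbol y_j(t)+\beta(t-T_a)\boldsymbol\phi_{i,j}(t)$, where $\beta$ is the step function; only the values of $\boldsymbol\phi_{i,j}$ on $[T_a,\infty)$ matter. Detector (UIO): $\dot{\boldsymbol z}_{i,j}=F_j\boldsymbol z_{i,j}+\hat K_j\boldsymbol y^c_{i,j}$, $\hat{\boldsymbol x}_{i,j}=\boldsymbol z_{i,j}+H_j\boldsymbol y^c_{i,j}$, with residual $\boldsymbol r_{i,j}=\boldsymbol y^c_{i,j}-\hat{\boldsymbol x}_{i,j}$. The real $3\times3$ parameter matrices satisfy $$T_j\bar E_j=0,\quad T_j=I-H_j,\quad \hat K_j=K_{j1}+K_{j2},\quad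 F_j=T_jA_{kj}-K_{j1},\quad K_{j2}=F_jH_j,$$ where $K_{j1}$ is chosen so that $F_j$ is Hurwitz, and $H_j=\begin{bmatrix}1&h_{12}&0\\0&h_{22}&0\\0&h_{32}&1\end{bmatrix}$ with $h_{12},h_{22},h_{32}$ arbitrary scalars. Malicious residual component: the residual under attack is the sum of the attack-free residual and a component $\boldsymbol r^a_{i,j}$ due to the attack, with $\boldsymbol r^a_{i,j}(t)=\mathbf 0$ for $0\le t<T_a$ and, for $t\ge T_a$, $$\boldsymbol r^a_{i,j}(t)=e^{F_j(t-T_a)}H_j\boldsymbol\phi_{i,j}(T_a)+T_j\boldsymbol\phi_{i,j}(t)-\int_{T_a}^te^{F_j(t-\tau)}\hat K_j\boldsymbol\phi_{i,j}(\tau)\,d\tau .$$ ZTS attack: the attack is ZTS if $\boldsymbol\phi_{i,j}(t)\ne\mathbf 0$ for some $t$ (at which the attack is active, $t\ge T_a$) and $\boldsymbol r^a_{i,j}(t)=\mathbf 0$ for all $t\ge0$.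
   Formalization: The scalars are assumed not to be (h12,h22,h32) = (0,1,0), i.e. T_j ≠ 0; for T_j = 0 the claim is false, since then every nonzero attack vector with φ(T_a) = 0 is ZTS, e.g. φ(t) = (t−T_a)e_2. *)

theory Defs
  imports "HOL-Analysis.Analysis"
begin

text \<open>
  HOL-Analysis has no exponential for \<^typ>\<open>real^'n^'n\<close>: the class-based \<^const>\<open>exp\<close> does not
  apply there, and the class-based product is componentwise.  Hence powers are taken with
  respect to the matrix product.
\<close>

definition mat_pow :: "real^'n^'n \<Rightarrow> nat \<Rightarrow> real^'n^'n" where
  "mat_pow M k = (((**) M) ^^ k) (mat 1)"

definition mat_exp :: "real^'n^'n \<Rightarrow> real^'n^'n" where
  "mat_exp M = (\<Sum>k. (1 / fact k) *\<^sub>R mat_pow M k)"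

text \<open>The eigenvalues in question are the complex ones, with complex eigenvectors.\<close>

definition hurwitz :: "real^'n^'n \<Rightarrow> bool" where
  "hurwitz M \<longleftrightarrow>
     (\<forall>(\<mu>::complex) (v::complex^'n).
        v \<noteq> 0 \<and> map_matrix complex_of_real M *v v = \<mu> *s v \<longrightarrow> Re \<mu> < 0)"

definition E_bar :: "real \<Rightarrow> real^2^3" where
  "E_bar Ct = vector [vector [1 / Ct, 0],
                      vector [0,      0],
                      vector [0,      1]]"

definition H_mat :: "real \<Rightarrow> real \<Rightarrow> real \<Rightarrow> real^3^3" where
  "H_mat h12 h22 h32 = vector [vector [1, h12, 0],
                               vector [0, h22, 0],
                               vector [0, h32, 1]]"

text \<open>
  The contribution of the attack \<open>\<phi>\<close>, starting at time \<open>Ta\<close>, to the residual of the observer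
  with parameter matrices \<open>F\<close>, \<open>T\<close>, \<open>H\<close> and \<open>Khat\<close>.  Only \<open>\<phi>\<close> on \<open>{Ta..}\<close> enters.
\<close>

definition malicious_residual ::
  "real^3^3 \<Rightarrow> real^3^3 \<Rightarrow> real^3^3 \<Rightarrow> real^3^3 \<Rightarrow> real \<Rightarrow> (real \<Rightarrow> real^3) \<Rightarrow> real \<Rightarrow> real^3" where
  "malicious_residual F T H Khat Ta \<phi> t =
     (if t < Ta then 0
      else mat_exp ((t - Ta) *\<^sub>R F) *v (H *v \<phi> Ta) + T *v \<phi> t
           - integral {Ta..t} (\<lambda>\<tau>. mat_exp ((t - \<tau>) *\<^sub>R F) *v (Khat *v \<phi> \<tau>)))"

definition zero_trace_stealthy ::
  "real^3^3 \<Rightarrow> real^3^3 \<Rightarrow> real^3^3 \<Rightarrow> real^3^3 \<Rightarrow> real \<Rightarrow> (real \<Rightarrow> real^3) \<Rightarrow> bool" where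
  "zero_trace_stealthy F T H Khat Ta \<phi> \<longleftrightarrow>
     (\<exists>t\<ge>Ta. \<phi> t \<noteq> 0) \<and> (\<forall>t\<ge>0. malicious_residual F T H Khat Ta \<phi> t = 0)"

end

theory Submission
  imports Defs
begin

text \<open>
  Because \<open>Khat = K1 + F (1 - T) = T A - F T\<close>, the malicious residual \<open>r\<close> solves the linear
  initial value problem \<open>r' = F r + T (\<phi>' - A \<phi>)\<close>, \<open>r Ta = \<phi> Ta\<close> on \<open>{Ta..}\<close>.  By uniqueness of
  solutions it vanishes iff \<open>\<phi> Ta = 0\<close> and \<open>\<phi>' - A \<phi>\<close> takes values in the kernel of \<open>T\<close>, which is
  the range of \<open>E_bar Ct\<close>.  Uniqueness for \<open>\<phi>' = A \<phi>\<close> shows that the fake input is nonzero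
  somewhere iff \<open>\<phi>\<close> is.
\<close>

section \<open>Exponential of a real square matrix\<close>

lemma bounded_bilinear_matrix_vector_mult:
  "bounded_bilinear ((*v) :: real^'n^'m \<Rightarrow> real^'n \<Rightarrow> real^'m)"
  unfolding bilinear_conv_bounded_bilinear[symmetric] bilinear_def
  by (auto intro!: linearI simp: matrix_vector_mult_add_rdistrib matrix_vector_right_distrib
      matrix_vector_mult_scaleR scaleR_matrix_vector_assoc)

lemma bounded_bilinear_matrix_matrix_mult:
  "bounded_bilinear ((**) :: real^'n^'m \<Rightarrow> real^'k^'n \<Rightarrow> real^'k^'m)"
  unfolding bilinear_conv_bounded_bilinear[symmetric] bilinear_def
  by (auto intro!: linearI simp: matrix_matrix_mult_def vec_eq_iff sum.distrib sum_distrib_left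
      algebra_simps)

lemmas bounded_linear_matrix_mult_left =
    bounded_bilinear.bounded_linear_left[OF bounded_bilinear_matrix_matrix_mult]
  and bounded_linear_matrix_mult_right =
    bounded_bilinear.bounded_linear_right[OF bounded_bilinear_matrix_matrix_mult]

lemma mat_pow_0 [simp]: "mat_pow M 0 = mat 1"
  and mat_pow_Suc [simp]: "mat_pow M (Suc k) = M ** mat_pow M k"
  by (simp_all add: mat_pow_def)

lemma mat_pow_commute: "M ** mat_pow M k = mat_pow M k ** M"
  by (induction k) (simp_all, metis matrix_mul_assoc)

lemma mat_pow_scaleR: "mat_pow (t *\<^sub>R M) k = t ^ k *\<^sub>R mat_pow M k"
  by (induction k) (simp_all add: scalar_matrix_assoc matrix_scalar_ac mult_ac)

text \<open>\<open>K\<close> bounds the linear map \<open>X \<mapsto> M ** X\<close>, and each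
  further power of \<open>M\<close> costs one factor \<open>K\<close>. The norm here is Euclidean,
  so \<open>norm (mat 1)\<close> need not be 1 and stays as a factor.\<close>

lemma norm_mat_pow_le:
  fixes M :: "real^'n^'n"
  obtains K where "\<And>k. norm (mat_pow M k) \<le> K ^ k * norm (mat 1 :: real^'n^'n)"
proof -
  obtain K where "K > 0" and K: "\<And>X :: real^'n^'n. norm (M ** X) \<le> norm X * K"
    using bounded_linear.pos_bounded[OF bounded_linear_matrix_mult_right] by blast
  have "norm (mat_pow M k) \<le> K ^ k * norm (mat 1 :: real^'n^'n)" for k
  proof (induction k)
    case (Suc k)
    have "norm (M ** mat_pow M k) \<le> norm (mat_pow M k) * K" by (rule K)
    also have "\<dots> \<le> (K ^ k * norm (mat 1 :: real^'n^'n)) * K"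
      using Suc \<open>K > 0\<close> by (intro mult_right_mono) auto
    finally show ?case by (simp add: mult_ac)
  qed simp
  then show thesis by (rule that)
qed

lemma summable_mat_exp:
  fixes M :: "real^'n^'n"
  shows "summable (\<lambda>k. (1 / fact k) *\<^sub>R mat_pow M k)"
proof -
  obtain K where K: "\<And>k. norm (mat_pow M k) \<le> K ^ k * norm (mat 1 :: real^'n^'n)"
    using norm_mat_pow_le[of M] by blast
  show ?thesis
  proof (rule summable_comparison_test)
    show "summable (\<lambda>k. inverse (fact k) * K ^ k * norm (mat 1 :: real^'n^'n))"
      by (intro summable_mult2 summable_exp)
    show "\<exists>N. \<forall>k\<ge>N. norm ((1 / fact k) *\<^sub>R mat_pow M k)
        \<le> inverse (fact k) * K ^ k * norm (mat 1 :: real^'n^'n)"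
      using K by (auto simp: divide_simps)
  qed
qed

text \<open>Used with left and right multiplication by \<open>M\<close>, and with inner products
  against a fixed matrix, which turn the matrix series into a scalar one.\<close>

lemma mat_exp_linear_image:
  assumes "bounded_linear f"
  shows "summable (\<lambda>k. (1 / fact k) *\<^sub>R f (mat_pow M k))"
    and "f (mat_exp M) = (\<Sum>k. (1 / fact k) *\<^sub>R f (mat_pow M k))"
  using bounded_linear.summable[OF assms summable_mat_exp[of M]]
    bounded_linear.suminf[OF assms summable_mat_exp[of M]]
  by (simp_all add: mat_exp_def linear_scale[OF bounded_linear.linear[OF assms]])

lemma mat_exp_0 [simp]: "mat_exp (0 :: real^'n^'n) = mat 1"
proof -
  have "(1 / fact k) *\<^sub>R mat_pow (0 :: real^'n^'n) k = (if k = 0 then mat 1 else 0)" for k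
    by (cases k) auto
  then show ?thesis
    using sums_unique[OF sums_single[of 0 "\<lambda>_. mat 1 :: real^'n^'n"]]
    by (simp only: mat_exp_def)
qed

lemma mat_exp_commute: "M ** mat_exp (t *\<^sub>R M) = mat_exp (t *\<^sub>R M) ** M"
  unfolding mat_exp_linear_image(2)[OF bounded_linear_matrix_mult_right]
    mat_exp_linear_image(2)[OF bounded_linear_matrix_mult_left]
  by (simp add: mat_pow_scaleR matrix_scalar_ac scalar_matrix_assoc[symmetric] mat_pow_commute)

text \<open>Each component of \<open>mat_exp (t *\<^sub>R M)\<close> is a scalar power series in
  \<open>t\<close> that converges everywhere, so it may be differentiated term by term.\<close>

lemma mat_exp_has_vector_derivative:
  fixes M :: "real^'n^'n"
  shows "((\<lambda>t. mat_exp (t *\<^sub>R M)) has_vector_derivative M ** mat_exp (t *\<^sub>R M)) (at t within S)"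
  unfolding has_vector_derivative_def
proof (subst has_derivative_componentwise_within, rule ballI)
  fix b :: "real^'n^'n"
  have bl: "bounded_linear (\<lambda>X. X \<bullet> b)" by (rule bounded_linear_inner_left)
  have bl': "bounded_linear (\<lambda>X. (M ** X) \<bullet> b)"
    by (rule bounded_linear_compose[OF bl bounded_linear_matrix_mult_right])
  define c where "c k = (mat_pow M k \<bullet> b) / fact k" for k
  have "summable (\<lambda>k. c k * y ^ k)"
    and exp: "mat_exp (y *\<^sub>R M) \<bullet> b = (\<Sum>k. c k * y ^ k)" for y
    using mat_exp_linear_image[OF bl, of "y *\<^sub>R M"] by (simp_all add: c_def mat_pow_scaleR mult_ac)
  then have "((\<lambda>y. \<Sum>k. c k * y ^ k) has_field_derivative (\<Sum>k. diffs c k * t ^ k)) (at t)"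
    by (intro termdiffs_strong_converges_everywhere)
  \<comment> \<open>\<open>diffs c k\<close> equals \<open>(k + 1) * c (k + 1)\<close>: the factor
    cancels against the factorial, and the shifted index supplies the extra factor
    \<open>M\<close>.\<close>
  moreover have "(\<Sum>k. diffs c k * t ^ k) = (M ** mat_exp (t *\<^sub>R M)) \<bullet> b"
    using mat_exp_linear_image(2)[OF bl', of "t *\<^sub>R M"]
    by (simp add: c_def diffs_def mat_pow_scaleR matrix_scalar_ac scalar_matrix_assoc[symmetric] mult_ac del: of_nat_Suc)
  ultimately have "((\<lambda>y. mat_exp (y *\<^sub>R M) \<bullet> b) has_field_derivative
      (M ** mat_exp (t *\<^sub>R M)) \<bullet> b) (at t within S)"
    unfolding exp by (auto intro: has_field_derivative_at_within)
  then show "((\<lambda>x. mat_exp (x *\<^sub>R M) \<bullet> b) has_derivative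
      (\<lambda>x. x *\<^sub>R (M ** mat_exp (t *\<^sub>R M)) \<bullet> b)) (at t within S)"
    by (simp add: has_field_derivative_def mult_commute_abs)
qed

section \<open>Linear differential equations with constant coefficients\<close>

lemma mat_exp_neg_has_vector_derivative:
  "((\<lambda>t. mat_exp ((c - t) *\<^sub>R M)) has_vector_derivative - (mat_exp ((c - t) *\<^sub>R M) ** M))
     (at t within S)"
proof -
  have "((\<lambda>t. c - t) has_vector_derivative - 1) (at t within S)"
    by (auto intro!: derivative_eq_intros)
  from vector_diff_chain_within[OF this mat_exp_has_vector_derivative]
  show ?thesis by (simp add: o_def mat_exp_commute)
qed

text \<open>The product \<open>mat_exp ((c - s) *\<^sub>R M) *v x s\<close> is constant in
  \<open>s\<close>: by the product rule the terms from the exponential and from \<open>x\<close>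
  cancel. The free constant \<open>c\<close> serves both uniqueness (\<open>c = t\<close>) and the
  addition law (\<open>c = s + t\<close>).\<close>

lemma linear_ode_solution:
  fixes M :: "real^'n^'n"
  assumes "convex S" "a \<in> S" "t \<in> S"
    and "\<And>s. s \<in> S \<Longrightarrow> (x has_vector_derivative M *v x s) (at s within S)"
  shows "mat_exp ((c - t) *\<^sub>R M) *v x t = mat_exp ((c - a) *\<^sub>R M) *v x a"
proof (rule has_derivative_zero_unique[OF assms(1) _ assms(3,2)])
  fix s assume "s \<in> S"
  from bounded_bilinear.has_vector_derivative[OF bounded_bilinear_matrix_vector_mult
      mat_exp_neg_has_vector_derivative[where M = M and c = c] assms(4)[OF this]]
  show "((\<lambda>s. mat_exp ((c - s) *\<^sub>R M) *v x s) has_derivative (\<lambda>h. 0)) (at s within S)"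
    by (simp add: has_vector_derivative_def matrix_vector_mul_assoc 
       bounded_bilinear.minus_left[OF bounded_bilinear_matrix_vector_mult])
qed

lemma linear_ode_unique_zero:
  fixes M :: "real^'n^'n"
  assumes "convex S" "a \<in> S" "t \<in> S" "x a = 0"
    and "\<And>s. s \<in> S \<Longrightarrow> (x has_vector_derivative M *v x s) (at s within S)"
  shows "x t = 0"
  using linear_ode_solution[OF assms(1-3,5), of t] assms(4) by simp

text \<open>Follows from the constancy above, applied to the solution
  \<open>mat_exp (t *\<^sub>R M) *v v\<close> at the times \<open>t\<close> and 0, instead of from a
  product of series.\<close>

lemma mat_exp_add: "mat_exp ((s + t) *\<^sub>R M) = mat_exp (s *\<^sub>R M) ** mat_exp (t *\<^sub>R M)"
proof -
  have "mat_exp (s *\<^sub>R M) *v (mat_exp (t *\<^sub>R M) *v v) = mat_exp ((s + t) *\<^sub>R M) *v v" for v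
  proof -
    have "((\<lambda>t. mat_exp (t *\<^sub>R M) *v v) has_vector_derivative M *v (mat_exp (r *\<^sub>R M) *v v))
        (at r within UNIV)" for r
      using bounded_linear.has_vector_derivative[OF
          bounded_bilinear.bounded_linear_left[OF bounded_bilinear_matrix_vector_mult]
          mat_exp_has_vector_derivative]
      by (simp add: matrix_vector_mul_assoc)
    from linear_ode_solution[OF convex_UNIV UNIV_I UNIV_I this, of "s + t" t 0]
    show ?thesis by simp
  qed
  then show ?thesis by (simp add: matrix_eq matrix_vector_mul_assoc[symmetric])
qed


lemma continuous_on_mat_exp:
  "continuous_on S (\<lambda>t. mat_exp (f t *\<^sub>R M))" if "continuous_on S f"
proof (rule continuous_on_compose2[OF _ that subset_UNIV])
  show "continuous_on UNIV (\<lambda>t. mat_exp (t *\<^sub>R M))"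
    by (rule continuous_on_vector_derivative[OF mat_exp_has_vector_derivative])
qed

text \<open>The integrand depends on the upper limit \<open>t\<close>. The addition law pulls
  \<open>mat_exp ((t - a) *\<^sub>R M)\<close> out of the integral; what remains under it is free of
  \<open>t\<close>, so the fundamental theorem of calculus and the product rule apply.\<close>

lemma variation_of_constants:
  fixes M :: "real^'n^'n" and g :: "real \<Rightarrow> real^'n" and x :: "real^'n"
  assumes "continuous_on {a..} g" "a \<le> t"
  defines "u \<equiv> \<lambda>t. mat_exp ((t - a) *\<^sub>R M) *v x
    + integral {a..t} (\<lambda>\<tau>. mat_exp ((t - \<tau>) *\<^sub>R M) *v g \<tau>)"
  shows "(u has_vector_derivative M *v u t + g t) (at t within {a..})"
proof -
  let ?h = "\<lambda>\<tau>. mat_exp ((a - \<tau>) *\<^sub>R M) *v g \<tau>"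
  have cont: "continuous_on {a..s} ?h" for s
    by (intro bounded_bilinear.continuous_on[OF bounded_bilinear_matrix_vector_mult]
        continuous_on_mat_exp continuous_intros continuous_on_subset[OF assms(1)]) auto
  have u: "u s = mat_exp ((s - a) *\<^sub>R M) *v (x + integral {a..s} ?h)" for s
  proof -
    have "mat_exp ((s - a) *\<^sub>R M) *v ?h \<tau> = mat_exp ((s - \<tau>) *\<^sub>R M) *v g \<tau>" for \<tau>
      using mat_exp_add[of "s - a" "a - \<tau>" M] by (simp add: matrix_vector_mul_assoc)
    with integral_linear[OF integrable_continuous_real[OF cont]
        bounded_bilinear.bounded_linear_right[OF bounded_bilinear_matrix_vector_mult],
        of s "mat_exp ((s - a) *\<^sub>R M)"]
    show ?thesis by (simp add: u_def o_def matrix_vector_right_distrib)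
  qed
  have "((\<lambda>s. x + integral {a..s} ?h) has_vector_derivative ?h t) (at t within {a..t + 1})"
    using has_vector_derivative_add[OF has_vector_derivative_const
        integral_has_vector_derivative[OF cont]] \<open>a \<le> t\<close> by simp
  \<comment> \<open>The fundamental theorem works on a compact interval; ending it at
    \<open>t + 1\<close> keeps \<open>t\<close> away from its right end, so the derivative is the
    one within the half-line.\<close>
  moreover have "at t within {a..t + 1} = at t within {a..}"
    by (rule at_within_nhd[of t "{..<t + 1}"]) auto
  ultimately have I: "((\<lambda>s. x + integral {a..s} ?h) has_vector_derivative ?h t) (at t within {a..})"
    by simp
  have "((\<lambda>s. s - a) has_vector_derivative 1) (at t within {a..})"
    by (auto intro!: derivative_eq_intros)
  from vector_diff_chain_within[OF this mat_exp_has_vector_derivative]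
  have E: "((\<lambda>s. mat_exp ((s - a) *\<^sub>R M)) has_vector_derivative M ** mat_exp ((t - a) *\<^sub>R M))
      (at t within {a..})"
    by (simp add: o_def)
  \<comment> \<open>The two exponentials are inverse to each other.\<close>
  have "mat_exp ((t - a) *\<^sub>R M) *v ?h t = g t"
    using mat_exp_add[of "t - a" "a - t" M, symmetric] by (simp add: matrix_vector_mul_assoc)
  then show ?thesis
    using bounded_bilinear.has_vector_derivative[OF bounded_bilinear_matrix_vector_mult E I]
    unfolding u[abs_def] by (simp add: matrix_vector_mul_assoc add.commute)
qed

section \<open>Differential equation of the malicious residual\<close>

lemma at_within_Ici_neq_bot:
  fixes t :: real
  assumes "a \<le> t"
  shows "at t within {a..} \<noteq> bot"
proof -
  have "at_right t \<le> at t within {a..}"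
    using assms by (intro at_le) auto
  then show ?thesis
    using trivial_limit_at_right_real[of t] by (metis bot.extremum_uniqueI)
qed

text \<open>On \<open>{Ta..}\<close> the residual minus \<open>T *v \<phi>\<close> is a
  variation-of-constants expression with forcing \<open>- (Khat *v \<phi>)\<close> and initial value
  \<open>H *v \<phi> Ta\<close>.\<close>

lemma malicious_residual_has_vector_derivative:
  assumes "T = mat 1 - H" "Khat = T ** A - F ** T" "Ta \<le> t"
    and \<phi>': "\<And>s. s \<ge> Ta \<Longrightarrow> (\<phi> has_vector_derivative \<phi>' s) (at s within {Ta..})"
  defines "r \<equiv> malicious_residual F T H Khat Ta \<phi>"
  shows "(r has_vector_derivative F *v r t + T *v (\<phi>' t - A *v \<phi> t)) (at t within {Ta..})"
proof -
  define u where "u t = mat_exp ((t - Ta) *\<^sub>R F) *v (H *v \<phi> Ta)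
    + integral {Ta..t} (\<lambda>\<tau>. mat_exp ((t - \<tau>) *\<^sub>R F) *v (- (Khat *v \<phi> \<tau>)))" for t
  have r: "r s = u s + T *v \<phi> s" if "s \<in> {Ta..}" for s
    using that by (simp add: r_def u_def malicious_residual_def
        bounded_bilinear.minus_right[OF bounded_bilinear_matrix_vector_mult])
  have "continuous_on {Ta..} \<phi>"
    using \<phi>' by (intro continuous_on_vector_derivative) auto
  then have "continuous_on {Ta..} (\<lambda>\<tau>. - (Khat *v \<phi> \<tau>))"
    by (intro continuous_on_minus
        bounded_linear.continuous_on[OF matrix_vector_mul_bounded_linear])
  from variation_of_constants[OF this \<open>Ta \<le> t\<close>, of F "H *v \<phi> Ta"]
  have "(u has_vector_derivative F *v u t - Khat *v \<phi> t) (at t within {Ta..})"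
    by (simp add: u_def[abs_def])
  moreover have "((\<lambda>s. T *v \<phi> s) has_vector_derivative T *v \<phi>' t) (at t within {Ta..})"
    using bounded_linear.has_vector_derivative[OF
        bounded_bilinear.bounded_linear_right[OF bounded_bilinear_matrix_vector_mult]
        \<phi>'[OF \<open>Ta \<le> t\<close>]] .
  ultimately have "((\<lambda>s. u s + T *v \<phi> s) has_vector_derivative
      F *v u t - Khat *v \<phi> t + T *v \<phi>' t) (at t within {Ta..})"
    by (rule has_vector_derivative_add)
  \<comment> \<open>Substitute \<open>u = r - T *v \<phi>\<close>; the coefficient of
    \<open>\<phi>\<close> becomes \<open>- (F ** T + Khat)\<close>, which is
    \<open>- (T ** A)\<close>.\<close>
  moreover have "F *v u t - Khat *v \<phi> t + T *v \<phi>' t = F *v r t + T *v (\<phi>' t - A *v \<phi> t)"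
    using \<open>Ta \<le> t\<close> by (simp add: r assms(2) matrix_vector_mul_assoc algebra_simps
        matrix_vector_right_distrib matrix_vector_mult_diff_distrib matrix_vector_mult_diff_rdistrib)
  ultimately show ?thesis
    using \<open>Ta \<le> t\<close> r by (auto intro: has_vector_derivative_transform)
qed

lemma malicious_residual_before:
  "t < Ta \<Longrightarrow> malicious_residual F T H Khat Ta \<phi> t = 0"
  by (simp add: malicious_residual_def)

text \<open>At \<open>Ta\<close> the integral is empty and the exponential is the identity, so
  \<open>H + T = mat 1\<close> gives the value.\<close>

lemma malicious_residual_start:
  assumes "T = mat 1 - H"
  shows "malicious_residual F T H Khat Ta \<phi> Ta = \<phi> Ta"
  by (simp add: assms malicious_residual_def matrix_vector_mult_diff_rdistrib)

text \<open>\<open>\<phi>'\<close> is left open so that it can be instantiated both by the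
  derivative of a given attack and by the right-hand side of the attack equation.\<close>

lemma malicious_residual_eq_0_iff:
  assumes "T = mat 1 - H" "Khat = T ** A - F ** T"
    and \<phi>': "\<And>s. s \<ge> Ta \<Longrightarrow> (\<phi> has_vector_derivative \<phi>' s) (at s within {Ta..})"
  shows "(\<forall>t\<ge>Ta. malicious_residual F T H Khat Ta \<phi> t = 0) \<longleftrightarrow>
    \<phi> Ta = 0 \<and> (\<forall>t\<ge>Ta. T *v (\<phi>' t - A *v \<phi> t) = 0)"
    (is "(\<forall>t\<ge>Ta. ?r t = 0) \<longleftrightarrow> _")
proof safe
  note deriv = malicious_residual_has_vector_derivative[OF assms(1,2) _ \<phi>']
  assume r: "\<forall>t\<ge>Ta. ?r t = 0"
  then show "\<phi> Ta = 0"
    using malicious_residual_start[OF assms(1)] by (metis order_refl)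
  fix t assume "t \<ge> Ta"
  \<comment> \<open>A vanishing residual has derivative 0 and also \<open>F *v ?r t = 0\<close>, so
    uniqueness of the derivative forces the forcing term to vanish.\<close>
  have "(?r has_vector_derivative 0) (at t within {Ta..})"
    using r \<open>t \<ge> Ta\<close> by (auto intro: has_vector_derivative_transform[OF _ _ has_vector_derivative_const])
  moreover have "at t within {Ta..} \<noteq> bot"
    using \<open>t \<ge> Ta\<close> by (rule at_within_Ici_neq_bot)
  ultimately show "T *v (\<phi>' t - A *v \<phi> t) = 0"
    using vector_derivative_unique_within deriv[OF \<open>t \<ge> Ta\<close>] r \<open>t \<ge> Ta\<close> by fastforce
next
  note deriv = malicious_residual_has_vector_derivative[OF assms(1,2) _ \<phi>']
  fix t assume "\<phi> Ta = 0" "\<forall>t\<ge>Ta. T *v (\<phi>' t - A *v \<phi> t) = 0" "t \<ge> Ta"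
  then show "?r t = 0"
    using deriv malicious_residual_start[OF assms(1)]
    by (intro linear_ode_unique_zero[of "{Ta..}" Ta t ?r F]) auto
qed

section \<open>Kernel of \<open>T\<close> and range of \<open>E_bar Ct\<close>\<close>

lemma E_bar_mult: "E_bar Ct *v d = vector [d $ 1 / Ct, 0, d $ 2]"
  by (simp add: vec_eq_iff forall_3 E_bar_def matrix_vector_mult_def sum_2)

text \<open>The first and third columns of \<open>mat 1 - H_mat h12 h22 h32\<close> vanish, so
  \<open>T\<close> has rank one and sees only the second coordinate of \<open>v\<close>. That
  coordinate is 0 exactly on the range of \<open>E_bar Ct\<close>.\<close>

lemma kernel_eq_range_E_bar:
  assumes "Ct \<noteq> 0" "T = mat 1 - H_mat h12 h22 h32" "T \<noteq> 0"
  shows "T *v v = 0 \<longleftrightarrow> (\<exists>d. v = E_bar Ct *v d)"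
proof -
  have T: "T = (\<chi> i j. if j = 2 then (vector [- h12, 1 - h22, - h32] :: real^3) $ i else 0)"
    by (simp add: assms(2) vec_eq_iff forall_3 H_mat_def mat_def)
  have "T *v v = v $ 2 *\<^sub>R vector [- h12, 1 - h22, - h32]"
    by (simp add: T vec_eq_iff forall_3 matrix_vector_mult_def sum_3)
  moreover have "vector [- h12, 1 - h22, - h32] \<noteq> (0 :: real^3)"
    using \<open>T \<noteq> 0\<close> by (auto simp: T vec_eq_iff split: if_splits)
  ultimately have "T *v v = 0 \<longleftrightarrow> v $ 2 = 0"
    by simp
  also have "\<dots> \<longleftrightarrow> (\<exists>d. v = E_bar Ct *v d)"
  proof
    assume "v $ 2 = 0"
    \<comment> \<open>The factor \<open>Ct\<close> undoes the entry \<open>1 / Ct\<close> of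
      \<open>E_bar Ct\<close>.\<close>
    then have "v = E_bar Ct *v vector [Ct * v $ 1, v $ 3]"
      using \<open>Ct \<noteq> 0\<close> by (simp add: E_bar_mult vec_eq_iff forall_3)
    then show "\<exists>d. v = E_bar Ct *v d" ..
  qed (auto simp: E_bar_mult)
  finally show ?thesis .
qed

theorem theorem1:
  fixes A T H K1 K2 Khat F :: "real^3^3"
    and Ct Ta h12 h22 h32 :: real
    and \<phi> :: "real \<Rightarrow> real^3"
  assumes "Ct > 0"
    and "T ** E_bar Ct = 0"
    and "T = mat 1 - H"
    and "Khat = K1 + K2"
    and "F = T ** A - K1"
    and "K2 = F ** H"
    and "H = H_mat h12 h22 h32"
    and "hurwitz F"
    and "T \<noteq> 0"
    and "Ta \<ge> 0"
    and "continuous_on {Ta..} \<phi>"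
    and "\<phi> differentiable_on {Ta..}"
  shows "zero_trace_stealthy F T H Khat Ta \<phi> \<longleftrightarrow>
    (\<exists>d :: real \<Rightarrow> real^2.
       (\<forall>t\<ge>Ta. (\<phi> has_vector_derivative (A *v \<phi> t + E_bar Ct *v d t)) (at t within {Ta..}))
       \<and> \<phi> Ta = 0
       \<and> (\<exists>t\<ge>Ta. E_bar Ct *v d t \<noteq> 0))"
    (is "?zts \<longleftrightarrow> (\<exists>d. ?ode d \<and> \<phi> Ta = 0 \<and> ?active d)")
proof -
  \<comment> \<open>With \<open>K1 = T ** A - F\<close> and \<open>K2 = F ** H\<close>, this
    collapses the observer gain to \<open>T ** A - F ** T\<close>.\<close>
  have "F ** T = F - F ** H"
    using bounded_bilinear.diff_right[OF bounded_bilinear_matrix_matrix_mult, of F "mat 1" H]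
    by (simp add: assms(3))
  then have Khat: "Khat = T ** A - F ** T"
    by (simp add: assms(4,6)) (simp add: assms(5))
  have zts: "?zts \<longleftrightarrow> (\<exists>t\<ge>Ta. \<phi> t \<noteq> 0) \<and> (\<forall>t\<ge>Ta. malicious_residual F T H Khat Ta \<phi> t = 0)"
    using \<open>Ta \<ge> 0\<close> malicious_residual_before[of _ Ta F T H Khat \<phi>]
    unfolding zero_trace_stealthy_def by (metis order_trans not_le)
  have ker: "T *v v = 0 \<longleftrightarrow> (\<exists>d. v = E_bar Ct *v d)" for v
    using kernel_eq_range_E_bar[of Ct T h12 h22 h32 v] assms(1,3,7,9) by simp
  show ?thesis
  proof
    assume ?zts
    define \<phi>' where "\<phi>' t = vector_derivative \<phi> (at t within {Ta..})" for t
    have \<phi>': "\<And>t. t \<ge> Ta \<Longrightarrow> (\<phi> has_vector_derivative \<phi>' t) (at t within {Ta..})"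
      using assms(12) by (simp add: \<phi>'_def differentiable_on_def flip: vector_derivative_works)
    from \<open>?zts\<close> have "\<phi> Ta = 0" and "\<forall>t\<ge>Ta. \<exists>d. \<phi>' t - A *v \<phi> t = E_bar Ct *v d"
      using malicious_residual_eq_0_iff[OF assms(3) Khat \<phi>'] by (simp_all add: zts ker)
    \<comment> \<open>The fake input is chosen pointwise in \<open>t\<close>; no regularity of
      \<open>d\<close> is claimed.\<close>
    then obtain d where "\<And>t. t \<ge> Ta \<Longrightarrow> \<phi>' t = A *v \<phi> t + E_bar Ct *v d t"
      by (metis add.commute diff_add_cancel)
    with \<phi>' have ode: "?ode d" by auto
    have "?active d"
    proof (rule ccontr)
      \<comment> \<open>Without input the equation is homogeneous with zero initial value, so the
        attack itself would vanish.\<close>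
      assume "\<not> ?active d"
      with ode have "\<And>t. t \<ge> Ta \<Longrightarrow> (\<phi> has_vector_derivative A *v \<phi> t) (at t within {Ta..})"
        by auto
      then have "\<phi> t = 0" if "t \<ge> Ta" for t
        using that \<open>\<phi> Ta = 0\<close> by (intro linear_ode_unique_zero[of "{Ta..}" Ta t \<phi> A]) auto
      with \<open>?zts\<close> show False by (auto simp: zts)
    qed
    with ode \<open>\<phi> Ta = 0\<close> show "\<exists>d. ?ode d \<and> \<phi> Ta = 0 \<and> ?active d" by blast
  next
    assume "\<exists>d. ?ode d \<and> \<phi> Ta = 0 \<and> ?active d"
    then obtain d where ode: "?ode d" and "\<phi> Ta = 0" and "?active d" by blast
    \<comment> \<open>Here the forcing term is \<open>T *v (E_bar Ct *v d t)\<close>, which is 0 by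
      \<open>ker\<close>.\<close>
    from \<open>\<phi> Ta = 0\<close> have "\<forall>t\<ge>Ta. malicious_residual F T H Khat Ta \<phi> t = 0"
      using ode by (subst malicious_residual_eq_0_iff[OF assms(3) Khat,
            where \<phi>' = "\<lambda>t. A *v \<phi> t + E_bar Ct *v d t"]) (auto simp: ker)
    moreover have "\<exists>t\<ge>Ta. \<phi> t \<noteq> 0"
    proof (rule ccontr)
      assume "\<not> (\<exists>t\<ge>Ta. \<phi> t \<noteq> 0)"
      then have 0: "\<phi> t = 0" if "t \<ge> Ta" for t using that by blast
      \<comment> \<open>If \<open>\<phi>\<close> vanishes, the attack equation says that
        \<open>E_bar Ct *v d t\<close> is its derivative, which is also 0.\<close>
      have "E_bar Ct *v d t = 0" if "t \<ge> Ta" for t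
      proof (rule vector_derivative_unique_within)
        show "at t within {Ta..} \<noteq> bot"
          using that by (rule at_within_Ici_neq_bot)
        show "(\<phi> has_vector_derivative E_bar Ct *v d t) (at t within {Ta..})"
          using ode that 0 by force
        show "(\<phi> has_vector_derivative 0) (at t within {Ta..})"
          using that 0 by (auto intro: has_vector_derivative_transform[OF _ _ has_vector_derivative_const])
      qed
      with \<open>?active d\<close> show False by blast
    qed
    ultimately show ?zts by (simp add: zts)
  qed
qed

end
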